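(* Let $(X,d)$ be a metric space. Then the following are equivalent. (a) $(X,d)$ is a UC space. (b) For every metric space $(Y,\rho)$ and every continuous function $f:(X,d)\to(Y,\rho)$, $f$ is strongly uniformly continuous on each subset of $X$. (c) For every metric space $(Y,\rho)$ and every continuous function $f:(X,d)\to(Y,\rho)$, $f$ is strongly uniformly continuous on each closed subset of $X$.
   Context: A metric space is a UC space if each real-valued continuous function defined on it is uniformly continuous. A function $f:(X,d)\to(Y,\rho)$ between metric spaces is strongly uniformly continuous on $B\subseteq X$ if for every $\epsilon>0$ there exists $\delta>0$ such that if $x,y\in X$, $d(x,y)<\delta$ and $\{x,y\}\cap B\neq\emptyset$, then $\rho(f(x),f(y))<\epsilon$. *)

theory Defs
  imports "HOL-Analysis.Analysis"
begin

definition UC_space :: "'a metric \<Rightarrow> bool" where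
  "UC_space X \<longleftrightarrow>
    (\<forall>f :: 'a \<Rightarrow> real. continuous_map (mtopology_of X) euclideanreal f \<longrightarrow>
       uniformly_continuous_map X euclidean_metric f)"

text \<open>Only \<open>x\<close> or \<open>y\<close> has to lie in \<open>B\<close>; the other point ranges over the whole space. So this is
  stronger than uniform continuity of the restriction of \<open>f\<close> to \<open>B\<close>.\<close>

definition strongly_uniformly_continuous_on ::
    "'a metric \<Rightarrow> 'b metric \<Rightarrow> 'a set \<Rightarrow> ('a \<Rightarrow> 'b) \<Rightarrow> bool" where
  "strongly_uniformly_continuous_on X Y B f \<longleftrightarrow>
    f \<in> mspace X \<rightarrow> mspace Y \<and>
    (\<forall>\<epsilon>>0. \<exists>\<delta>>0. \<forall>x\<in>mspace X. \<forall>y\<in>mspace X.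
       mdist X x y < \<delta> \<and> {x, y} \<inter> B \<noteq> {} \<longrightarrow> mdist Y (f x) (f y) < \<epsilon>)"

text \<open>HOL cannot quantify over types inside a formula. To say ``for every metric space \<open>Y\<close>'',
  take \<open>Y :: ('b + real) metric\<close> with \<open>'b\<close> an arbitrary type: \<open>Y\<close> then ranges over
  all metric spaces whose carrier is any subset of \<open>'b + real\<close>. Every metric space over a type
  \<open>'b\<close> is isometric (via \<open>Inl\<close>) to one of these. The summand \<open>real\<close> is needed because a
  type \<open>'b\<close> that is too small (e.g. finite) would make the quantification too weak to
  characterise UC spaces.\<close>

end

theory Submission
  imports Defs "HOL-Library.Ramsey"
begin

text \<open>
  Strong uniform continuity on the whole space is uniform continuity, and it passes to subsets, so
  both (b) and (c) say that every continuous map from \<open>X\<close> into a metric space over \<open>'b + real\<close> is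
  uniformly continuous. Real-valued maps are a special case of this, since the real line has an isometric
  copy inside \<open>'b + real\<close>. The content of the theorem is that real-valued maps suffice
  (\<open>UC_space_imp_uniformly_continuous_map\<close>).

  Let \<open>f\<close> be continuous but not uniformly continuous: there are points \<open>x n\<close>, \<open>y n\<close> at distance
  tending to \<open>0\<close> whose images stay \<open>\<epsilon>\<close> apart. The distance from \<open>f z\<close> to a set of points \<open>f (x n)\<close>
  is a continuous real-valued function of \<open>z\<close> that vanishes at these \<open>x n\<close>. It fails to be
  uniformly continuous as soon as it is bounded below by a positive constant on the corresponding
  \<open>y n\<close>, so an infinite set of indices has to be chosen such that every \<open>f (y m)\<close> is far from every
  \<open>f (x n)\<close>, and not only from its own partner. That this is possible is Efremovich's lemma, obtained here from Ramsey's theorem.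
\<close>

text \<open>
  Colour a pair of indices \<open>i < j\<close> by telling whether \<open>u i\<close> is within \<open>\<epsilon>/4\<close> of \<open>v j\<close>, and whether
  \<open>u j\<close> is within \<open>\<epsilon>/4\<close> of \<open>v i\<close>. On an infinite homogeneous set neither can happen: if \<open>u i\<close> were so close to \<open>v j\<close>
  for all \<open>i < j\<close>, then for \<open>i < j < k\<close> the chain \<open>u j\<close>, \<open>v k\<close>, \<open>u i\<close>, \<open>v j\<close> of three steps, each
  shorter than \<open>\<epsilon>/4\<close>, would contradict \<open>\<epsilon> \<le> d (u j) (v j)\<close>; the other case is symmetric.
\<close>

lemma (in Metric_space) Efremovich_lemma:
  fixes u v :: "nat \<Rightarrow> 'a"
  assumes u: "\<And>n. u n \<in> M" and v: "\<And>n. v n \<in> M"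
    and "\<epsilon> > 0" and far: "\<And>n. \<epsilon> \<le> d (u n) (v n)"
  obtains I where "infinite I" "\<And>m n. m \<in> I \<Longrightarrow> n \<in> I \<Longrightarrow> \<epsilon>/4 \<le> d (u m) (v n)"
proof -
  define up where "up = (\<lambda>e. d (u (Min e)) (v (Max e)) < \<epsilon>/4)"
  define dn where "dn = (\<lambda>e. d (u (Max e)) (v (Min e)) < \<epsilon>/4)"
  define col :: "nat set \<Rightarrow> nat" where "col = (\<lambda>e. of_bool (up e) + 2 * of_bool (dn e))"
  have "\<forall>i\<in>UNIV. \<forall>j\<in>UNIV. i \<noteq> j \<longrightarrow> col {i, j} < 4"
    by (simp add: col_def)
  from Ramsey2[OF infinite_UNIV_nat this] obtain I t where I: "infinite I" "\<forall>i\<in>I. \<forall>j\<in>I. i \<noteq> j \<longrightarrow> col {i, j} = t"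
    by blast
  have col_iff: "col e = t \<Longrightarrow> (up e \<longleftrightarrow> odd t) \<and> (dn e \<longleftrightarrow> t \<ge> 2)" for e
    by (cases "up e"; cases "dn e") (auto simp: col_def)
  have up_iff: "d (u i) (v j) < \<epsilon>/4 \<longleftrightarrow> odd t" if "i \<in> I" "j \<in> I" "i < j" for i j
    using col_iff[of "{i, j}"] I(2) that by (auto simp: up_def)
  have dn_iff: "d (u j) (v i) < \<epsilon>/4 \<longleftrightarrow> t \<ge> 2" if "i \<in> I" "j \<in> I" "i < j" for i j
    using col_iff[of "{i, j}"] I(2) that by (auto simp: dn_def)
  have chain: "d a b \<le> d a p + d q p + d q b" if "a \<in> M" "b \<in> M" "p \<in> M" "q \<in> M" for a b p q
    using triangle[of a p b] triangle[of p q b] that by (simp add: commute)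
  obtain i where i: "i \<in> I"
    using I(1) by (meson infinite_nat_iff_unbounded)
  obtain j where j: "j \<in> I" "i < j"
    using I(1) by (meson infinite_nat_iff_unbounded)
  obtain k where k: "k \<in> I" "j < k"
    using I(1) by (meson infinite_nat_iff_unbounded)
  have "even t"
    using up_iff[OF i j] up_iff[OF j(1) k] up_iff[OF i k(1)] j(2) k(2)
      chain[OF u v v u, of j j k i] far[of j] \<open>\<epsilon> > 0\<close> by linarith
  moreover have "t < 2"
    using dn_iff[OF i j] dn_iff[OF j(1) k] dn_iff[OF i k(1)] j(2) k(2)
      chain[OF u v v u, of j j i k] far[of j] \<open>\<epsilon> > 0\<close> by linarith
  ultimately have "\<epsilon>/4 \<le> d (u m) (v n)" if "m \<in> I" "n \<in> I" for m n
    using that up_iff[of m n] dn_iff[of n m] far[of m] \<open>\<epsilon> > 0\<close>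
    by (cases m n rule: linorder_cases) auto
  then show thesis
    using that I(1) by blast
qed

lemma Lipschitz_continuous_map_dist_to_set:
  assumes S: "S \<subseteq> mspace Y" "S \<noteq> {}"
  shows "Lipschitz_continuous_map Y euclidean_metric (\<lambda>z. INF s\<in>S. mdist Y z s)"
proof -
  have bdd: "bdd_below ((\<lambda>s. mdist Y z s) ` S)" for z
    by (intro bdd_belowI2[of _ 0]) simp
  have le: "(INF s\<in>S. mdist Y a s) - mdist Y a b \<le> (INF s\<in>S. mdist Y b s)"
    if "a \<in> mspace Y" "b \<in> mspace Y" for a b
  proof (rule cINF_greatest[OF S(2)])
    fix s assume "s \<in> S"
    then have "(INF s\<in>S. mdist Y a s) \<le> mdist Y a s"
      by (rule cINF_lower[OF bdd])
    also have "\<dots> \<le> mdist Y a b + mdist Y b s"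
      using \<open>s \<in> S\<close> S(1) that by (intro mdist_triangle) auto
    finally show "(INF s\<in>S. mdist Y a s) - mdist Y a b \<le> mdist Y b s"
      by simp
  qed
  show ?thesis
    unfolding Lipschitz_continuous_map_def
  proof (intro conjI exI[of _ 1] ballI)
    fix a b assume "a \<in> mspace Y" "b \<in> mspace Y"
    then show "mdist euclidean_metric (INF s\<in>S. mdist Y a s) (INF s\<in>S. mdist Y b s)
        \<le> 1 * mdist Y a b"
      using le[of a b] le[of b a] by (simp add: dist_real_def mdist_commute abs_le_iff)
  qed simp
qed

theorem UC_space_imp_uniformly_continuous_map:
  assumes UC: "UC_space X" and f: "continuous_map (mtopology_of X) (mtopology_of Y) f"
  shows "uniformly_continuous_map X Y f"
proof (rule ccontr)
  assume not_uc: "\<not> uniformly_continuous_map X Y f"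
  have funspace: "f \<in> mspace X \<rightarrow> mspace Y"
    using continuous_map_funspace[OF f] by simp
  from not_uc funspace obtain \<epsilon> where "\<epsilon> > 0" and
    \<epsilon>: "\<And>\<delta>. \<delta> > 0 \<Longrightarrow> \<exists>x\<in>mspace X. \<exists>y\<in>mspace X. mdist X y x < \<delta> \<and> \<epsilon> \<le> mdist Y (f y) (f x)"
    unfolding uniformly_continuous_map_def by (meson not_le)
  have "\<forall>n. \<exists>x y. x \<in> mspace X \<and> y \<in> mspace X \<and> mdist X y x < inverse (Suc n)
      \<and> \<epsilon> \<le> mdist Y (f y) (f x)"
    using \<epsilon> by (metis inverse_positive_iff_positive of_nat_0_less_iff zero_less_Suc)
  then obtain x y :: "nat \<Rightarrow> 'a" where x: "\<And>n. x n \<in> mspace X" and y: "\<And>n. y n \<in> mspace X"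
    and near: "\<And>n. mdist X (y n) (x n) < inverse (Suc n)"
    and far: "\<And>n. \<epsilon> \<le> mdist Y (f (y n)) (f (x n))"
    by metis
  have fx: "f (x n) \<in> mspace Y" and fy: "f (y n) \<in> mspace Y" for n
    using funspace x y by auto
  interpret Y: Metric_space "mspace Y" "mdist Y"
    by (rule Metric_space_mspace_mdist)
  obtain I where I: "infinite I"
    and sep: "\<And>m n. m \<in> I \<Longrightarrow> n \<in> I \<Longrightarrow> \<epsilon>/4 \<le> mdist Y (f (y m)) (f (x n))"
    using Y.Efremovich_lemma[of "\<lambda>n. f (y n)" "\<lambda>n. f (x n)" \<epsilon>] fx fy \<open>\<epsilon> > 0\<close> far by metis
  define S where "S = (\<lambda>n. f (x n)) ` I"
  have S: "S \<subseteq> mspace Y" "S \<noteq> {}"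
    using I fx by (auto simp: S_def)
  define h where "h = (\<lambda>z. INF s\<in>S. mdist Y z s) \<circ> f"
  have "continuous_map (mtopology_of X) euclideanreal h"
    unfolding h_def
    using continuous_map_compose[OF f
        Lipschitz_continuous_imp_continuous_map[OF Lipschitz_continuous_map_dist_to_set[OF S]]]
    by simp
  then have "uniformly_continuous_map X euclidean_metric h"
    using UC unfolding UC_space_def by blast
  then obtain \<delta> where "\<delta> > 0" and
    \<delta>: "\<And>a b. a \<in> mspace X \<Longrightarrow> b \<in> mspace X \<Longrightarrow> mdist X b a < \<delta> \<Longrightarrow> dist (h b) (h a) < \<epsilon>/4"
    unfolding uniformly_continuous_map_def using \<open>\<epsilon> > 0\<close>
    by (metis divide_pos_pos mdist_euclidean_metric zero_less_numeral)
  obtain N where N: "inverse (real (Suc N)) < \<delta>"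
    using reals_Archimedean[OF \<open>\<delta> > 0\<close>] by blast
  obtain n where n: "n \<in> I" "N < n"
    using I by (meson infinite_nat_iff_unbounded)
  have "inverse (real (Suc n)) \<le> inverse (real (Suc N))"
    using n(2) by (intro le_imp_inverse_le) auto
  then have "dist (h (y n)) (h (x n)) < \<epsilon>/4"
    using near[of n] N by (intro \<delta> x y) linarith
  moreover have "h (x n) \<le> 0"
  proof -
    have "bdd_below (mdist Y (f (x n)) ` S)"
      by (intro bdd_belowI2[of _ 0]) simp
    then have "h (x n) \<le> mdist Y (f (x n)) (f (x n))"
      unfolding h_def comp_def using n(1) by (intro cINF_lower) (auto simp: S_def)
    then show ?thesis
      using fx[of n] by simp
  qed
  moreover have "\<epsilon>/4 \<le> h (y n)"
    unfolding h_def comp_def using n(1) sep by (intro cINF_greatest[OF S(2)]) (auto simp: S_def)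
  ultimately show False
    unfolding dist_real_def by linarith
qed

lemma strongly_uniformly_continuous_on_mspace_iff:
  "strongly_uniformly_continuous_on X Y (mspace X) f \<longleftrightarrow> uniformly_continuous_map X Y f"
proof -
  have "mdist X x y < \<delta> \<and> {x, y} \<inter> mspace X \<noteq> {} \<longleftrightarrow> mdist X y x < \<delta>" if "x \<in> mspace X" for x y \<delta>
    using that by (auto simp: mdist_commute)
  then show ?thesis
    unfolding strongly_uniformly_continuous_on_def uniformly_continuous_map_def
    by (simp add: mdist_commute[of Y] cong: ball_cong)
qed

lemma strongly_uniformly_continuous_on_subset:
  assumes "strongly_uniformly_continuous_on X Y A f" "B \<subseteq> A"
  shows "strongly_uniformly_continuous_on X Y B f"
proof -
  have "{x, y} \<inter> A \<noteq> {}" if "{x, y} \<inter> B \<noteq> {}" for x y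
    using that assms(2) by auto
  then show ?thesis
    using assms(1) unfolding strongly_uniformly_continuous_on_def by meson
qed

definition Inr_real_metric :: "('b + real) metric" where
  "Inr_real_metric = metric (range Inr, \<lambda>a b. dist (projr a) (projr b))"

lemma Metric_space_Inr_real:
  "Metric_space (range (Inr :: real \<Rightarrow> 'b + real)) (\<lambda>a b. dist (projr a) (projr b))"
  by unfold_locales (auto simp: dist_commute dist_triangle)

lemma mspace_Inr_real_metric [simp]: "mspace Inr_real_metric = range Inr"
  and mdist_Inr_real_metric [simp]: "mdist Inr_real_metric a b = dist (projr a) (projr b)"
  unfolding Inr_real_metric_def
  by (simp_all add: Metric_space.mspace_metric[OF Metric_space_Inr_real]
      Metric_space.mdist_metric[OF Metric_space_Inr_real])

lemma continuous_map_Inr_real_metric: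
  assumes "continuous_map T euclideanreal f"
  shows "continuous_map T (mtopology_of Inr_real_metric) (Inr \<circ> f)"
proof -
  have "Lipschitz_continuous_map euclidean_metric Inr_real_metric Inr"
    unfolding Lipschitz_continuous_map_def by (auto intro: exI[of _ 1])
  then show ?thesis
    using continuous_map_compose[OF assms] Lipschitz_continuous_imp_continuous_map by fastforce
qed

text \<open>
  The whole space is closed in itself, which is why a condition on closed subsets is enough; it is
  applied to real-valued functions carried over to the copy of the real line.
\<close>

lemma UC_space_if_strongly_uniformly_continuous_on_mspace:
  fixes X :: "'a metric"
  assumes "\<And>(Y :: ('b + real) metric) f. continuous_map (mtopology_of X) (mtopology_of Y) f \<Longrightarrow>
      strongly_uniformly_continuous_on X Y (mspace X) f"
  shows "UC_space X"
  unfolding UC_space_def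
proof (intro allI impI)
  fix f :: "'a \<Rightarrow> real"
  assume "continuous_map (mtopology_of X) euclideanreal f"
  then have "uniformly_continuous_map X (Inr_real_metric :: ('b + real) metric) (Inr \<circ> f)"
    using assms continuous_map_Inr_real_metric strongly_uniformly_continuous_on_mspace_iff by blast
  then show "uniformly_continuous_map X euclidean_metric f"
    by (simp add: uniformly_continuous_map_def)
qed

theorem theorem11:
  fixes X :: "'a metric"
  shows "(UC_space X \<longleftrightarrow>
           (\<forall>(Y :: ('b + real) metric) f. continuous_map (mtopology_of X) (mtopology_of Y) f \<longrightarrow>
              (\<forall>B. B \<subseteq> mspace X \<longrightarrow> strongly_uniformly_continuous_on X Y B f))) \<and>
         (UC_space X \<longleftrightarrow>
           (\<forall>(Y :: ('b + real) metric) f. continuous_map (mtopology_of X) (mtopology_of Y) f \<longrightarrow>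
              (\<forall>B. closedin (mtopology_of X) B \<longrightarrow> strongly_uniformly_continuous_on X Y B f)))"
proof -
  have all: "strongly_uniformly_continuous_on X Y B f"
    if "UC_space X" "continuous_map (mtopology_of X) (mtopology_of Y) f" "B \<subseteq> mspace X"
    for Y :: "('b + real) metric" and f B
    using UC_space_imp_uniformly_continuous_map[OF that(1,2)] that(3)
    by (metis strongly_uniformly_continuous_on_mspace_iff strongly_uniformly_continuous_on_subset)
  have closed_subset: "B \<subseteq> mspace X" if "closedin (mtopology_of X) B" for B
    using closedin_subset[OF that] by simp
  have closed_mspace: "closedin (mtopology_of X) (mspace X)"
    using closedin_topspace[of "mtopology_of X"] by simp
  show ?thesis
  proof (intro conjI iffI)
    assume *: "\<forall>(Y :: ('b + real) metric) f. continuous_map (mtopology_of X) (mtopology_of Y) f \<longrightarrow>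
        (\<forall>B. B \<subseteq> mspace X \<longrightarrow> strongly_uniformly_continuous_on X Y B f)"
    show "UC_space X"
      by (rule UC_space_if_strongly_uniformly_continuous_on_mspace[where 'b='b])
        (rule *[rule_format], simp_all)
  next
    assume *: "\<forall>(Y :: ('b + real) metric) f. continuous_map (mtopology_of X) (mtopology_of Y) f \<longrightarrow>
        (\<forall>B. closedin (mtopology_of X) B \<longrightarrow> strongly_uniformly_continuous_on X Y B f)"
    show "UC_space X"
      by (rule UC_space_if_strongly_uniformly_continuous_on_mspace[where 'b='b])
        (rule *[rule_format], simp_all add: closed_mspace)
  qed (use all closed_subset in simp_all)
qed

end
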